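(* Let $\Sigma_S$ be the input-output stochastic differential system $dx=f(x,u)\,dt+h(x,u)\,d\omega$, $y=s(x,u)$. If the unforced diffusion term $h(x,0_m)$ does not vanish at any state $x\in\mathbb{R}^n$, i.e. $h(x,0_m)\ne 0_{n\times r}$ for all $x\in\mathbb{R}^n$, then there does not exist any radially unbounded Lyapunov function with respect to which $\Sigma_S$ is stochastically passive.
   Context: In $\Sigma_S$, $x\in\mathbb{R}^n$ is the state, $u\in\mathbb{U}\subseteq\mathbb{R}^m$ the input with $0_m\in\mathbb{U}$, $y\in\mathbb{R}^m$ the output, $\omega$ a standard $r$-dimensional Wiener process, and $f:\mathbb{R}^n\times\mathbb{U}\to\mathbb{R}^n$, $h:\mathbb{R}^n\times\mathbb{U}\to\mathbb{R}^{n\times r}$, $s:\mathbb{R}^n\times\mathbb{U}\to\mathbb{R}^m$ are locally Lipschitz continuous. The infinitesimal generator is $\mathcal{L}[V]=\frac{\partial V}{\partial x}f+\frac12\mathrm{tr}\{\frac{\partial^2 V}{\partial x^2}hh^\top\}$. $\Sigma_S$ is stochastically passive with respect to a nonnegative $C^2$ function $S:\mathbb{R}^n\to\mathbb{R}$ (the storage function) if $\mathcal{L}[S(x)]\le u^\top y$ for all $x\in\mathbb{R}^n$ and $u\in\mathbb{U}$, where $y=s(x,u)$. "Radially unbounded Lyapunov function" means a $C^2$ function $V:\mathbb{R}^n\to\mathbb{R}$ that is positive definite with respect to $x-\bar x$ for some state $\bar x$ (i.e. $V(\bar x)=0$ and $V(x)>0$ for $x\neq\bar x$) and satisfies $V(x)\to\infty$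 as $\|x\|_2\to\infty$; it is used as the storage function. *)

theory Defs
  imports "HOL-Analysis.Analysis"
begin

definition locally_lipschitz_on :: "'a::metric_space set \<Rightarrow> ('a \<Rightarrow> 'b::metric_space) \<Rightarrow> bool" where
  "locally_lipschitz_on D F \<longleftrightarrow>
     (\<forall>p\<in>D. \<exists>e>0. \<exists>L. L-lipschitz_on (cball p e \<inter> D) F)"

definition partial :: "'n::finite \<Rightarrow> (real^'n \<Rightarrow> real) \<Rightarrow> real^'n \<Rightarrow> real" where
  "partial i V x = frechet_derivative V (at x) (axis i 1)"

definition gradient :: "(real^'n::finite \<Rightarrow> real) \<Rightarrow> real^'n \<Rightarrow> real^'n" where
  "gradient V x = (\<chi> i. partial i V x)"

definition hessian :: "(real^'n::finite \<Rightarrow> real) \<Rightarrow> real^'n \<Rightarrow> real^'n^'n" where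
  "hessian V x = (\<chi> i j. partial j (partial i V) x)"

definition twice_continuously_differentiable :: "(real^'n::finite \<Rightarrow> real) \<Rightarrow> bool" where
  "twice_continuously_differentiable V \<longleftrightarrow>
     (\<forall>x. V differentiable (at x)) \<and>
     (\<forall>i x. partial i V differentiable (at x)) \<and>
     (\<forall>i j. continuous_on UNIV (partial j (partial i V)))"

(* The system dx = f(x,u) dt + h(x,u) d\<omega>, y = s(x,u) is given by its coefficients and
   its input set U. The functions are total on the ambient space of U, but only their
   values on inputs in U are constrained or used. An element of real^'r^'n is a matrix
   with rows indexed by 'n and columns indexed by 'r. *)

definition stochastic_system ::
  "(real^'m::finite) set \<Rightarrow> (real^'n::finite \<Rightarrow> real^'m \<Rightarrow> real^'n) \<Rightarrow>
   (real^'n \<Rightarrow> real^'m \<Rightarrow> real^'r::finite^'n) \<Rightarrow> (real^'n \<Rightarrow> real^'m \<Rightarrow> real^'m) \<Rightarrow> bool" where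
  "stochastic_system U f h s \<longleftrightarrow>
     0 \<in> U \<and>
     locally_lipschitz_on (UNIV \<times> U) (\<lambda>(x, u). f x u) \<and>
     locally_lipschitz_on (UNIV \<times> U) (\<lambda>(x, u). h x u) \<and>
     locally_lipschitz_on (UNIV \<times> U) (\<lambda>(x, u). s x u)"

definition generator ::
  "(real^'n::finite \<Rightarrow> real^'m::finite \<Rightarrow> real^'n) \<Rightarrow> (real^'n \<Rightarrow> real^'m \<Rightarrow> real^'r::finite^'n) \<Rightarrow>
   (real^'n \<Rightarrow> real) \<Rightarrow> real^'n \<Rightarrow> real^'m \<Rightarrow> real" where
  "generator f h V x u =
     gradient V x \<bullet> f x u + 1/2 * trace (hessian V x ** (h x u ** transpose (h x u)))"

definition stochastically_passive ::
  "(real^'m::finite) set \<Rightarrow> (real^'n::finite \<Rightarrow> real^'m \<Rightarrow> real^'n) \<Rightarrow>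
   (real^'n \<Rightarrow> real^'m \<Rightarrow> real^'r::finite^'n) \<Rightarrow> (real^'n \<Rightarrow> real^'m \<Rightarrow> real^'m) \<Rightarrow>
   (real^'n \<Rightarrow> real) \<Rightarrow> bool" where
  "stochastically_passive U f h s S \<longleftrightarrow>
     twice_continuously_differentiable S \<and> (\<forall>x. S x \<ge> 0) \<and>
     (\<forall>x. \<forall>u\<in>U. generator f h S x u \<le> u \<bullet> s x u)"

definition radially_unbounded_lyapunov :: "(real^'n::finite \<Rightarrow> real) \<Rightarrow> bool" where
  "radially_unbounded_lyapunov V \<longleftrightarrow>
     twice_continuously_differentiable V \<and>
     (\<exists>xbar. V xbar = 0 \<and> (\<forall>x. x \<noteq> xbar \<longrightarrow> V x > 0)) \<and>
     filterlim V at_top at_infinity"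

end

theory Submission
  imports Defs
begin

text \<open>
  Stochastically, the theorem says that a nonnegative supermartingale which starts at zero stays
  at zero. With zero input, passivity reads \<open>\<L>[V] \<le> 0\<close>, so \<open>V\<close> along the solution started at
  the minimiser \<open>a\<close> would be such a supermartingale; as \<open>V\<close> is positive elsewhere, the
  solution would have to rest at \<open>a\<close>, which the noise \<open>h(a, 0) \<noteq> 0\<close> forbids.

  The proof below replaces the process by a maximum principle argument, in which
  \<open>w(x) = |x - a|\<^sup>2\<close> is the test function. It satisfies
  \<open>\<L>[w](x) = 2 (x - a) \<bullet> f(x, 0) + |h(x, 0)|\<^sup>2\<close>, which is positive at \<open>a\<close> and hence on
  some closed ball around it. On the boundary sphere of this ball \<open>V\<close> has a positive lower
  bound, so for small \<open>\<epsilon> > 0\<close> the function \<open>V - \<epsilon> w\<close> is positive there although it vanishes at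
  \<open>a\<close>. It therefore attains its minimum over the ball at an interior point \<open>p\<close>
  (lemma \<open>interior_minimum_of_quadratic_perturbation\<close>).
  The first and second order conditions at \<open>p\<close> give \<open>\<L>[V](p) \<ge> \<epsilon> \<L>[w](p) > 0\<close>
  (lemma \<open>generator_ge_at_local_min\<close>), contradicting \<open>\<L>[V] \<le> 0\<close>.

  A degenerate matrix \<open>h h\<^sup>T\<close> causes no difficulty: the Hessian of \<open>w\<close> is twice the identity, so
  \<open>\<L>[w](a)\<close> is the trace of \<open>h h\<^sup>T\<close>, which is positive as soon as one entry of \<open>h\<close> is nonzero.
\<close>

section \<open>Continuity and one-dimensional minima\<close>

lemma locally_lipschitz_on_imp_continuous_on:
  assumes "locally_lipschitz_on D F"
  shows "continuous_on D F"
  unfolding continuous_on_eq_continuous_within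
proof
  fix p assume p: "p \<in> D"
  then obtain e L where e: "e > 0" and L: "L-lipschitz_on (cball p e \<inter> D) F"
    using assms unfolding locally_lipschitz_on_def by blast
  have "continuous (at p within (cball p e \<inter> D)) F"
    using lipschitz_on_continuous_on[OF L] p e
    by (auto simp: continuous_on_eq_continuous_within)
  moreover have "at p within (cball p e \<inter> D) = at p within D"
    by (rule at_within_nhd[of p "ball p e"]) (use e in auto)
  ultimately show "continuous (at p within D) F" by simp
qed

lemma continuous_on_fixed_input:
  assumes "locally_lipschitz_on (UNIV \<times> U) (\<lambda>(x, u). g x u)" and "u \<in> U"
  shows "continuous_on UNIV (\<lambda>x. g x u)"
proof -
  have "continuous_on UNIV ((\<lambda>(x, u). g x u) \<circ> (\<lambda>x. (x, u)))"
    by (rule continuous_on_compose)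
      (use assms in \<open>auto intro!: continuous_intros
        intro: continuous_on_subset[OF locally_lipschitz_on_imp_continuous_on]\<close>)
  then show ?thesis by (simp add: o_def)
qed

lemma second_derivative_nonneg_at_local_min:
  fixes \<phi> \<phi>' :: "real \<Rightarrow> real"
  assumes deriv: "\<And>t. (\<phi> has_real_derivative \<phi>' t) (at t)"
    and deriv2: "(\<phi>' has_real_derivative c) (at a)"
    and "d > 0" and min: "\<And>t. \<bar>t - a\<bar> < d \<Longrightarrow> \<phi> a \<le> \<phi> t"
  shows "c \<ge> 0"
proof (rule ccontr)
  assume "\<not> c \<ge> 0"
  then have "c < 0" by simp
  have "\<phi>' a = 0"
    using DERIV_local_min[OF deriv \<open>d > 0\<close>] min by (simp add: abs_minus_commute)
  \<comment> \<open>The slope vanishes at \<open>a\<close> and strictly decreases there, so \<open>\<phi>\<close> drops to the right of \<open>a\<close>.\<close>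
  with DERIV_neg_dec_right[OF deriv2 \<open>c < 0\<close>] obtain d' where "d' > 0"
    and neg: "\<And>t. 0 < t \<Longrightarrow> t < d' \<Longrightarrow> \<phi>' (a + t) < 0" by auto
  define t where "t = min d d' / 2"
  have t: "0 < t" "t < d" "t < d'" using \<open>d > 0\<close> \<open>d' > 0\<close> by (auto simp: t_def)
  obtain z where z: "a < z" "z < a + t" "\<phi> (a + t) - \<phi> a = (a + t - a) * \<phi>' z"
    using MVT2[of a "a + t" \<phi> \<phi>'] deriv t by auto
  have "\<phi>' z < 0" using neg[of "z - a"] z t by simp
  then have "\<phi> (a + t) < \<phi> a" using z(3) t by (smt (verit) mult_pos_neg)
  moreover have "\<phi> a \<le> \<phi> (a + t)" using t by (intro min) auto
  ultimately show False by simp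
qed

section \<open>Derivatives along a line\<close>

lemma inner_gradient:
  assumes "V differentiable (at x)"
  shows "gradient V x \<bullet> v = frechet_derivative V (at x) v"
proof -
  have lin: "linear (frechet_derivative V (at x))"
    using assms by (rule linear_frechet_derivative)
  have "frechet_derivative V (at x) v = frechet_derivative V (at x) (\<Sum>i\<in>UNIV. v $ i *\<^sub>R axis i 1)"
    by (simp add: basis_expansion scalar_mult_eq_scaleR[symmetric])
  also have "\<dots> = (\<Sum>i\<in>UNIV. v $ i * partial i V x)"
    by (simp add: linear_sum[OF lin] linear_cmul[OF lin] partial_def)
  finally show ?thesis
    by (simp add: gradient_def inner_vec_def mult.commute)
qed

lemma has_real_derivative_along_line:
  assumes "V differentiable (at (p + t *\<^sub>R v))"
  shows "((\<lambda>t. V (p + t *\<^sub>R v)) has_real_derivative gradient V (p + t *\<^sub>R v) \<bullet> v) (at t)"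
proof -
  let ?D = "frechet_derivative V (at (p + t *\<^sub>R v))"
  have V: "(V has_derivative ?D) (at (p + t *\<^sub>R v))"
    using assms frechet_derivative_works by blast
  have line: "((\<lambda>t. p + t *\<^sub>R v) has_derivative (\<lambda>\<tau>. \<tau> *\<^sub>R v)) (at t)"
    by (auto intro!: derivative_eq_intros)
  have "((\<lambda>t. V (p + t *\<^sub>R v)) has_derivative (\<lambda>\<tau>. ?D (\<tau> *\<^sub>R v))) (at t)"
    using diff_chain_at[OF line V] by (simp add: o_def)
  moreover have "?D (\<tau> *\<^sub>R v) = ?D v * \<tau>" for \<tau>
    using linear_cmul[OF linear_frechet_derivative[OF assms]] by simp
  ultimately show ?thesis
    by (simp add: has_field_derivative_def inner_gradient[OF assms])
qed

lemma has_real_derivative_gradient_along_line: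
  assumes "\<And>i. partial i V differentiable (at (p + t *\<^sub>R v))"
  shows "((\<lambda>t. gradient V (p + t *\<^sub>R v) \<bullet> v) has_real_derivative
           v \<bullet> (hessian V (p + t *\<^sub>R v) *v v)) (at t)"
proof -
  have "((\<lambda>t. \<Sum>i\<in>UNIV. partial i V (p + t *\<^sub>R v) * v $ i) has_real_derivative
          (\<Sum>i\<in>UNIV. (gradient (partial i V) (p + t *\<^sub>R v) \<bullet> v) * v $ i)) (at t)"
    by (intro DERIV_sum DERIV_cmult_right has_real_derivative_along_line assms)
  moreover have "(\<lambda>t. \<Sum>i\<in>UNIV. partial i V (p + t *\<^sub>R v) * v $ i)
      = (\<lambda>t. gradient V (p + t *\<^sub>R v) \<bullet> v)"
    by (simp add: gradient_def inner_vec_def)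
  moreover have "(\<Sum>i\<in>UNIV. (gradient (partial i V) y \<bullet> v) * v $ i) = v \<bullet> (hessian V y *v v)"
    for y
    by (simp add: gradient_def hessian_def inner_vec_def matrix_vector_mult_def mult.commute)
  ultimately show ?thesis by simp
qed

section \<open>The generator at a minimum of a quadratic perturbation\<close>

text \<open>
  The second order term of the generator is a sum of second directional derivatives, one along
  each column of the diffusion matrix; so the one-dimensional second order condition applies to
  each summand.
\<close>

lemma trace_mult_gram_eq_sum_columns:
  fixes H :: "real^'n::finite^'n" and B :: "real^'r::finite^'n"
  shows "trace (H ** (B ** transpose B)) = (\<Sum>k\<in>UNIV. column k B \<bullet> (H *v column k B))"
proof -
  have "trace (H ** (B ** transpose B)) = (\<Sum>i\<in>UNIV. \<Sum>j\<in>UNIV. \<Sum>k\<in>UNIV. B $ i $ k * (H $ i $ j * B $ j $ k))"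
    by (simp add: trace_def matrix_matrix_mult_def transpose_def sum_distrib_left mult_ac)
  also have "\<dots> = (\<Sum>i\<in>UNIV. \<Sum>k\<in>UNIV. \<Sum>j\<in>UNIV. B $ i $ k * (H $ i $ j * B $ j $ k))"
    by (intro sum.cong sum.swap refl)
  also have "\<dots> = (\<Sum>k\<in>UNIV. \<Sum>i\<in>UNIV. \<Sum>j\<in>UNIV. B $ i $ k * (H $ i $ j * B $ j $ k))"
    by (rule sum.swap)
  also have "\<dots> = (\<Sum>k\<in>UNIV. column k B \<bullet> (H *v column k B))"
    by (simp add: inner_vec_def matrix_vector_mult_def column_def sum_distrib_left)
  finally show ?thesis .
qed

lemma sum_inner_columns_pos:
  fixes B :: "real^'r::finite^'n::finite"
  assumes "B \<noteq> 0"
  shows "(\<Sum>k\<in>UNIV. column k B \<bullet> column k B) > 0"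
proof -
  obtain i k where "B $ i $ k \<noteq> 0"
    using assms by (auto simp: vec_eq_iff)
  then have "column k B \<noteq> 0"
    by (auto simp: vec_eq_iff column_def)
  then have "column k B \<bullet> column k B > 0" by simp
  then show ?thesis
    by (intro sum_pos2[of UNIV k]) auto
qed

text \<open>
  Restricting \<open>V - \<epsilon> w\<close>, with \<open>w(y) = |y - a|\<^sup>2\<close>, to the line through \<open>p\<close> in direction \<open>v\<close> gives a
  real function with a local minimum at the parameter of \<open>p\<close>. Its two derivative conditions are
  the conclusions, since \<open>w\<close> contributes the gradient \<open>2 (p - a)\<close> and the Hessian twice the identity.
\<close>

lemma conditions_at_local_min_of_quadratic_perturbation:
  fixes V :: "real^'n::finite \<Rightarrow> real"
  assumes V: "twice_continuously_differentiable V"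
    and "d > 0"
    and min: "\<And>y. dist y p < d \<Longrightarrow>
           V p - \<epsilon> * ((p - a) \<bullet> (p - a)) \<le> V y - \<epsilon> * ((y - a) \<bullet> (y - a))"
  shows "gradient V p \<bullet> v = 2 * \<epsilon> * ((p - a) \<bullet> v)"
    and "v \<bullet> (hessian V p *v v) \<ge> 2 * \<epsilon> * (v \<bullet> v)"
proof -
  define \<phi> where "\<phi> t = V (p + t *\<^sub>R v) - \<epsilon> * ((p + t *\<^sub>R v - a) \<bullet> (p + t *\<^sub>R v - a))" for t
  define \<phi>' where "\<phi>' t = gradient V (p + t *\<^sub>R v) \<bullet> v - 2 * \<epsilon> * ((p + t *\<^sub>R v - a) \<bullet> v)" for t
  have \<phi>_alt: "\<phi> t = V (p + t *\<^sub>R v)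
      - \<epsilon> * ((p - a) \<bullet> (p - a) + 2 * t * ((p - a) \<bullet> v) + t\<^sup>2 * (v \<bullet> v))" for t
    by (simp add: \<phi>_def algebra_simps inner_commute power2_eq_square)
  have \<phi>'_alt: "\<phi>' t = gradient V (p + t *\<^sub>R v) \<bullet> v - 2 * \<epsilon> * ((p - a) \<bullet> v + t * (v \<bullet> v))" for t
    by (simp add: \<phi>'_def algebra_simps)
  have deriv: "(\<phi> has_real_derivative \<phi>' t) (at t)" for t
    unfolding \<phi>_alt[abs_def] \<phi>'_alt
    by (rule derivative_eq_intros has_real_derivative_along_line
          V[unfolded twice_continuously_differentiable_def, THEN conjunct1, rule_format] refl)+
      (simp add: algebra_simps)
  have partials: "partial i V differentiable (at y)" for i y
    using V by (simp add: twice_continuously_differentiable_def)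
  have "(\<phi>' has_real_derivative (v \<bullet> (hessian V (p + 0 *\<^sub>R v) *v v) - 2 * \<epsilon> * (v \<bullet> v))) (at 0)"
    unfolding \<phi>'_alt[abs_def]
    by (rule derivative_eq_intros has_real_derivative_gradient_along_line partials refl)+ simp
  then have deriv2: "(\<phi>' has_real_derivative (v \<bullet> (hessian V p *v v) - 2 * \<epsilon> * (v \<bullet> v))) (at 0)"
    by simp
  \<comment> \<open>The \<open>+ 1\<close> keeps \<open>e\<close> positive when \<open>v\<close> is zero.\<close>
  define e where "e = d / (norm v + 1)"
  have "e > 0" using \<open>d > 0\<close> by (simp add: e_def add_nonneg_pos)
  have \<phi>_min: "\<phi> 0 \<le> \<phi> t" if "\<bar>t\<bar> < e" for t
  proof -
    have "\<bar>t\<bar> * norm v \<le> \<bar>t\<bar> * (norm v + 1)" by (simp add: mult_left_mono)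
    also have "\<dots> < d" using that by (simp add: e_def pos_less_divide_eq add_nonneg_pos)
    finally show ?thesis
      using min[of "p + t *\<^sub>R v"] by (simp add: \<phi>_def dist_norm)
  qed
  have "\<phi>' 0 = 0"
    using DERIV_local_min[OF deriv \<open>e > 0\<close>] \<phi>_min by simp
  then show "gradient V p \<bullet> v = 2 * \<epsilon> * ((p - a) \<bullet> v)" by (simp add: \<phi>'_def)
  have "v \<bullet> (hessian V p *v v) - 2 * \<epsilon> * (v \<bullet> v) \<ge> 0"
    using second_derivative_nonneg_at_local_min[OF deriv deriv2 \<open>e > 0\<close>] \<phi>_min by simp
  then show "v \<bullet> (hessian V p *v v) \<ge> 2 * \<epsilon> * (v \<bullet> v)" by simp
qed

text \<open>
  The factor of \<open>\<epsilon>\<close> on the right is the generator of the squared distance to \<open>a\<close>. Equality of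
  gradients at \<open>p\<close> handles the drift, and ordering of second derivatives along the columns of the
  diffusion matrix handles the rest.
\<close>

lemma generator_ge_at_local_min:
  fixes V :: "real^'n::finite \<Rightarrow> real"
  assumes V: "twice_continuously_differentiable V"
    and "d > 0"
    and min: "\<And>y. dist y p < d \<Longrightarrow>
           V p - \<epsilon> * ((p - a) \<bullet> (p - a)) \<le> V y - \<epsilon> * ((y - a) \<bullet> (y - a))"
  shows "generator f h V p u \<ge>
           \<epsilon> * (2 * ((p - a) \<bullet> f p u) + (\<Sum>k\<in>UNIV. column k (h p u) \<bullet> column k (h p u)))"
proof -
  note conds = conditions_at_local_min_of_quadratic_perturbation[OF V \<open>d > 0\<close> min]
  have "(\<Sum>k\<in>UNIV. 2 * \<epsilon> * (column k (h p u) \<bullet> column k (h p u)))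
      \<le> trace (hessian V p ** (h p u ** transpose (h p u)))"
    unfolding trace_mult_gram_eq_sum_columns by (intro sum_mono conds(2))
  then show ?thesis
    using conds(1)[of "f p u"]
    by (simp add: generator_def sum_distrib_left[symmetric] algebra_simps)
qed

lemma interior_minimum_of_quadratic_perturbation:
  fixes V :: "real^'n::finite \<Rightarrow> real"
  assumes cont: "continuous_on (cball a r) V" and "r > 0"
    and "V a = 0" and pos: "\<And>x. x \<noteq> a \<Longrightarrow> V x > 0"
  obtains \<epsilon> p where "\<epsilon> > 0" "p \<in> ball a r"
    "\<And>y. y \<in> cball a r \<Longrightarrow>
       V p - \<epsilon> * ((p - a) \<bullet> (p - a)) \<le> V y - \<epsilon> * ((y - a) \<bullet> (y - a))"
proof -
  have "sphere a r \<noteq> {}" using \<open>r > 0\<close> by simp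
  moreover have "continuous_on (sphere a r) V"
    using cont by (rule continuous_on_subset) auto
  ultimately obtain q where q: "q \<in> sphere a r" "\<And>y. y \<in> sphere a r \<Longrightarrow> V q \<le> V y"
    using continuous_attains_inf[of "sphere a r" V] by auto
  have "V q > 0" using q(1) \<open>r > 0\<close> by (intro pos) auto
  \<comment> \<open>On the sphere the perturbation equals half the minimum of \<open>V\<close> there.\<close>
  define \<epsilon> where "\<epsilon> = V q / (2 * r\<^sup>2)"
  have "\<epsilon> > 0" using \<open>V q > 0\<close> \<open>r > 0\<close> by (simp add: \<epsilon>_def)
  let ?W = "\<lambda>y. V y - \<epsilon> * ((y - a) \<bullet> (y - a))"
  have "continuous_on (cball a r) ?W"
    by (intro continuous_intros cont)
  then obtain p where p: "p \<in> cball a r" "\<And>y. y \<in> cball a r \<Longrightarrow> ?W p \<le> ?W y"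
    using continuous_attains_inf[of "cball a r" ?W] \<open>r > 0\<close> by auto
  have "p \<notin> sphere a r"
  proof
    assume p_sphere: "p \<in> sphere a r"
    then have "(p - a) \<bullet> (p - a) = r\<^sup>2"
      by (simp add: dist_norm norm_minus_commute power2_norm_eq_inner[symmetric])
    then have "?W p = V p - V q / 2" using \<open>r > 0\<close> by (simp add: \<epsilon>_def)
    moreover have "?W p \<le> 0" using p(2)[of a] \<open>r > 0\<close> \<open>V a = 0\<close> by simp
    ultimately show False using q(2)[OF p_sphere] \<open>V q > 0\<close> by simp
  qed
  with p(1) have "p \<in> ball a r" by auto
  with \<open>\<epsilon> > 0\<close> p(2) that show ?thesis by blast
qed

section \<open>Nonexistence of a passive storage function\<close>

theorem corollary2:
  fixes U :: "(real^'m::finite) set"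
    and f :: "real^'n::finite \<Rightarrow> real^'m \<Rightarrow> real^'n"
    and h :: "real^'n \<Rightarrow> real^'m \<Rightarrow> real^'r::finite^'n"
    and s :: "real^'n \<Rightarrow> real^'m \<Rightarrow> real^'m"
  assumes "stochastic_system U f h s"
    and "\<forall>x. h x 0 \<noteq> 0"
  shows "\<not> (\<exists>V. radially_unbounded_lyapunov V \<and> stochastically_passive U f h s V)"
proof
  assume "\<exists>V. radially_unbounded_lyapunov V \<and> stochastically_passive U f h s V"
  then obtain V where V: "twice_continuously_differentiable V"
    and passivity: "stochastically_passive U f h s V"
    and "\<exists>a. V a = 0 \<and> (\<forall>x. x \<noteq> a \<longrightarrow> V x > 0)"
    by (auto simp: radially_unbounded_lyapunov_def)
  then obtain a where a: "V a = 0" "\<And>x. x \<noteq> a \<Longrightarrow> V x > 0" by blast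
  have "0 \<in> U" using assms(1) by (simp add: stochastic_system_def)
  then have cont_f: "continuous_on UNIV (\<lambda>x. f x 0)" and cont_h: "continuous_on UNIV (\<lambda>x. h x 0)"
    using assms(1) by (auto simp: stochastic_system_def intro: continuous_on_fixed_input)
  define Lw where "Lw x = 2 * ((x - a) \<bullet> f x 0)
      + (\<Sum>k\<in>UNIV. column k (h x 0) \<bullet> column k (h x 0))" for x
  have "continuous_on UNIV Lw"
    unfolding Lw_def[abs_def] column_def
    by (intro continuous_intros cont_f cont_h)
  then have "open {x. Lw x > 0}" by (intro open_Collect_less continuous_intros)
  moreover have "a \<in> {x. Lw x > 0}"
    using sum_inner_columns_pos[of "h a 0"] assms(2) by (simp add: Lw_def)
  ultimately obtain r where "r > 0" and r: "\<And>x. x \<in> cball a r \<Longrightarrow> Lw x > 0"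
    using open_contains_cball by (metis (mono_tags, lifting) mem_Collect_eq subsetD)
  have "continuous_on (cball a r) V"
    using V by (auto simp: twice_continuously_differentiable_def
        intro!: differentiable_imp_continuous_on differentiable_at_imp_differentiable_on)
  then obtain \<epsilon> p where "\<epsilon> > 0" and p: "p \<in> ball a r"
    and min: "\<And>y. y \<in> cball a r \<Longrightarrow>
       V p - \<epsilon> * ((p - a) \<bullet> (p - a)) \<le> V y - \<epsilon> * ((y - a) \<bullet> (y - a))"
    using interior_minimum_of_quadratic_perturbation[of a r V] \<open>r > 0\<close> a by metis
  obtain d where "d > 0" and d: "ball p d \<subseteq> ball a r"
    using p open_ball open_contains_ball by blast
  have "\<epsilon> * Lw p \<le> generator f h V p 0"
    unfolding Lw_def
  proof (rule generator_ge_at_local_min[OF V \<open>d > 0\<close>])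
    fix y assume "dist y p < d"
    then have "y \<in> cball a r" using d by (auto simp: dist_commute subset_iff)
    then show "V p - \<epsilon> * ((p - a) \<bullet> (p - a)) \<le> V y - \<epsilon> * ((y - a) \<bullet> (y - a))" by (rule min)
  qed
  moreover have "\<epsilon> * Lw p > 0" using \<open>\<epsilon> > 0\<close> r[of p] p by simp
  moreover have "generator f h V p 0 \<le> 0"
    using passivity \<open>0 \<in> U\<close> unfolding stochastically_passive_def by (metis inner_zero_left)
  ultimately show False by simp
qed

end
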